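(* Let $H$ be a finitely generated group, and let $\mu$ be a probability measure on $\mathsf{Shuffler}(H)=\mathrm{FSym}(H)\rtimes H$. Suppose that $\mu$ has a finite first moment and that it induces a transient random walk on $H$. Then for any $h\in H$, the values $F_n(h)$, $n\ge 0$, of the permutation coordinate of the $\mu$-random walk $\{(F_n,S_n)\}_{n\ge0}$ almost surely stabilize to a limit value $F_\infty(h)$, i.e. almost surely there is $N\ge 1$ with $F_n(h)=F_N(h)=:F_\infty(h)$ for all $n\ge N$.
   Context: For a countable group $H$, $\mathrm{FSym}(H)$ is the group (under composition) of bijections $f:H\to H$ that are the identity outside a finite set. $H$ acts on it by $(h\cdot f)(x)=hf(h^{-1}x)$, and $\mathsf{Shuffler}(H):=\mathrm{FSym}(H)\rtimes H$ with product $(f,x)(g,y)=(f\circ(x\cdot g),xy)$. If $H$ is finitely generated, so is $\mathsf{Shuffler}(H)$. The $\mu$-random walk is $(F_n,S_n)=g_1g_2\cdots g_n$ with $g_i$ i.i.d. of law $\mu$, started at the identity; $F_n\in\mathrm{FSym}(H)$ is the permutation coordinate and $S_n\in H$. The induced random walk on $H$ is $\{S_n\}$ (driven by the push-forward of $\mu$ under the projection to $H$); it is transient if almost surely it visits $e_H$ only finitely many times. $\mu$ has a finite first moment if $\sum_g \ell(g)\mu(g)<\infty$ for some (equivalently, any) word length $\ell$ on $\mathsf{Shuffler}(H)$ associated with a finite generating set. *)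

theory Defs
  imports
    "HOL-Probability.Probability"
    "HOL-Algebra.Generated_Groups"
    "HOL-Combinatorics.Permutations"
begin

definition finitely_generated :: "('a, 'b) monoid_scheme \<Rightarrow> bool" where
  "finitely_generated G \<longleftrightarrow>
     (\<exists>S. finite S \<and> S \<subseteq> carrier G \<and> generate G S = carrier G)"

(* Permutations of the carrier are functions on the whole type that are the identity off the
   carrier, so that each permutation has a unique representative. *)
definition FSym :: "('a, 'b) monoid_scheme \<Rightarrow> ('a \<Rightarrow> 'a) monoid" where
  "FSym H = \<lparr>carrier = {f. f permutes carrier H \<and> finite {x. f x \<noteq> x}},
             mult = (\<lambda>f g. f \<circ> g), one = id\<rparr>"

definition FSym_act :: "('a, 'b) monoid_scheme \<Rightarrow> 'a \<Rightarrow> ('a \<Rightarrow> 'a) \<Rightarrow> 'a \<Rightarrow> 'a" where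
  "FSym_act H h f x =
     (if x \<in> carrier H then h \<otimes>\<^bsub>H\<^esub> f (inv\<^bsub>H\<^esub> h \<otimes>\<^bsub>H\<^esub> x) else x)"

definition Shuffler :: "('a, 'b) monoid_scheme \<Rightarrow> (('a \<Rightarrow> 'a) \<times> 'a) monoid" where
  "Shuffler H = \<lparr>carrier = carrier (FSym H) \<times> carrier H,
     mult = (\<lambda>(f, x) (g, y). (f \<otimes>\<^bsub>FSym H\<^esub> FSym_act H x g, x \<otimes>\<^bsub>H\<^esub> y)),
     one = (\<one>\<^bsub>FSym H\<^esub>, \<one>\<^bsub>H\<^esub>)\<rparr>"

(* Only meaningful when g lies in the subgroup generated by S; otherwise the LEAST ranges over
   an empty set. *)
definition word_length :: "('a, 'b) monoid_scheme \<Rightarrow> 'a set \<Rightarrow> 'a \<Rightarrow> nat" where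
  "word_length G S g =
     (LEAST n. \<exists>w. length w = n \<and> set w \<subseteq> S \<union> (\<lambda>s. inv\<^bsub>G\<^esub> s) ` S \<and>
                   foldr (\<lambda>a b. a \<otimes>\<^bsub>G\<^esub> b) w \<one>\<^bsub>G\<^esub> = g)"

definition finite_first_moment :: "('a, 'b) monoid_scheme \<Rightarrow> 'a pmf \<Rightarrow> bool" where
  "finite_first_moment G \<mu> \<longleftrightarrow>
     (\<exists>S. finite S \<and> S \<subseteq> carrier G \<and> generate G S = carrier G \<and>
          (\<lambda>g. real (word_length G S g) * pmf \<mu> g) summable_on carrier G)"

(* The increments are indexed by the positive integers: g 1, g 2, ...; the value g 0 is unused. *)
definition iid_increments ::
    "'w measure \<Rightarrow> (nat \<Rightarrow> 'w \<Rightarrow> 'a) \<Rightarrow> 'a pmf \<Rightarrow> bool" where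
  "iid_increments M g \<mu> \<longleftrightarrow>
     prob_space.indep_vars M (\<lambda>_. count_space UNIV) g {1..} \<and>
     (\<forall>i\<ge>1. distr M (count_space UNIV) (g i) = measure_pmf \<mu>)"

primrec random_walk ::
    "('a, 'b) monoid_scheme \<Rightarrow> (nat \<Rightarrow> 'w \<Rightarrow> 'a) \<Rightarrow> nat \<Rightarrow> 'w \<Rightarrow> 'a" where
  "random_walk G g 0 \<omega> = \<one>\<^bsub>G\<^esub>"
| "random_walk G g (Suc n) \<omega> = random_walk G g n \<omega> \<otimes>\<^bsub>G\<^esub> g (Suc n) \<omega>"

definition transient_walk ::
    "'w measure \<Rightarrow> ('a, 'b) monoid_scheme \<Rightarrow> (nat \<Rightarrow> 'w \<Rightarrow> 'a) \<Rightarrow> bool" where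
  "transient_walk M G X \<longleftrightarrow> (AE \<omega> in M. finite {n. X n \<omega> = \<one>\<^bsub>G\<^esub>})"

definition perm_coord ::
    "('a, 'b) monoid_scheme \<Rightarrow> (nat \<Rightarrow> 'w \<Rightarrow> ('a \<Rightarrow> 'a) \<times> 'a) \<Rightarrow> nat \<Rightarrow> 'w \<Rightarrow> 'a \<Rightarrow> 'a" where
  "perm_coord H g n \<omega> = fst (random_walk (Shuffler H) g n \<omega>)"

definition base_coord ::
    "('a, 'b) monoid_scheme \<Rightarrow> (nat \<Rightarrow> 'w \<Rightarrow> ('a \<Rightarrow> 'a) \<times> 'a) \<Rightarrow> nat \<Rightarrow> 'w \<Rightarrow> 'a" where
  "base_coord H g n \<omega> = snd (random_walk (Shuffler H) g n \<omega>)"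

lemma base_coord_eq_random_walk:
  "base_coord H g = random_walk H (\<lambda>i \<omega>. snd (g i \<omega>))"
proof (intro ext)
  fix n \<omega>
  show "base_coord H g n \<omega> = random_walk H (\<lambda>i \<omega>. snd (g i \<omega>)) n \<omega>"
    by (induction n) (simp_all add: base_coord_def Shuffler_def split_beta)
qed

lemma FSym_simps:
  "f \<in> carrier (FSym H) \<longleftrightarrow> f permutes carrier H \<and> finite {x. f x \<noteq> x}"
  "f \<otimes>\<^bsub>FSym H\<^esub> g = f \<circ> g"
  "\<one>\<^bsub>FSym H\<^esub> = id"
  by (simp_all add: FSym_def)

lemma group_FSym: "group (FSym H)"
proof (rule groupI)
  fix f g assume "f \<in> carrier (FSym H)" "g \<in> carrier (FSym H)"
  moreover have "{x. (f \<circ> g) x \<noteq> x} \<subseteq> {x. f x \<noteq> x} \<union> {x. g x \<noteq> x}" by auto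
  ultimately show "f \<otimes>\<^bsub>FSym H\<^esub> g \<in> carrier (FSym H)"
    unfolding FSym_simps by (meson finite_Un finite_subset permutes_compose)
next
  fix f assume f: "f \<in> carrier (FSym H)"
  have bij: "bij f" using f unfolding FSym_simps by (meson permutes_bij)
  have "{x. Hilbert_Choice.inv f x \<noteq> x} = {x. f x \<noteq> x}"
    using bij by (metis bij_inv_eq_iff)
  then have "Hilbert_Choice.inv f \<in> carrier (FSym H)"
    using f permutes_inv unfolding FSym_simps by fastforce
  moreover have "Hilbert_Choice.inv f \<circ> f = id"
    using bij by (simp add: bij_is_inj)
  ultimately show "\<exists>g\<in>carrier (FSym H). g \<otimes>\<^bsub>FSym H\<^esub> f = \<one>\<^bsub>FSym H\<^esub>"
    unfolding FSym_simps(2,3) by blast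
qed (auto simp: FSym_simps permutes_id comp_assoc)

lemma FSym_act_closed:
  assumes "group H" "h \<in> carrier H" "f \<in> carrier (FSym H)"
  shows "FSym_act H h f \<in> carrier (FSym H)"
proof -
  interpret group H by fact
  have f: "f permutes carrier H" and fin: "finite {x. f x \<noteq> x}"
    using assms(3) by (auto simp: FSym_simps)
  have fc: "f x \<in> carrier H" if "x \<in> carrier H" for x
    using f that by (simp add: permutes_in_image)
  have "bij_betw (\<lambda>x. inv\<^bsub>H\<^esub> h \<otimes>\<^bsub>H\<^esub> x) (carrier H) (carrier H)"
    by (rule bij_betwI[where g = "\<lambda>x. h \<otimes>\<^bsub>H\<^esub> x"])
       (use assms(2) in \<open>auto simp: m_assoc[symmetric]\<close>)
  moreover have "bij_betw f (carrier H) (carrier H)"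
    using f by (rule permutes_imp_bij)
  moreover have "bij_betw (\<lambda>x. h \<otimes>\<^bsub>H\<^esub> x) (carrier H) (carrier H)"
    by (rule bij_betwI[where g = "\<lambda>x. inv\<^bsub>H\<^esub> h \<otimes>\<^bsub>H\<^esub> x"])
       (use assms(2) in \<open>auto simp: m_assoc[symmetric]\<close>)
  ultimately have "bij_betw ((\<lambda>x. h \<otimes>\<^bsub>H\<^esub> x) \<circ> (f \<circ> (\<lambda>x. inv\<^bsub>H\<^esub> h \<otimes>\<^bsub>H\<^esub> x)))
      (carrier H) (carrier H)"
    by (blast intro: bij_betw_trans)
  then have "bij_betw (FSym_act H h f) (carrier H) (carrier H)"
    by (rule bij_betw_cong[THEN iffD1, rotated]) (simp add: FSym_act_def)
  then have "FSym_act H h f permutes carrier H"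
    by (rule bij_imp_permutes) (simp add: FSym_act_def)
  moreover have "{x. FSym_act H h f x \<noteq> x} \<subseteq> (\<lambda>x. h \<otimes>\<^bsub>H\<^esub> x) ` {x. f x \<noteq> x}"
  proof
    fix x assume "x \<in> {x. FSym_act H h f x \<noteq> x}"
    then have x: "x \<in> carrier H" and ne: "h \<otimes>\<^bsub>H\<^esub> f (inv\<^bsub>H\<^esub> h \<otimes>\<^bsub>H\<^esub> x) \<noteq> x"
      by (auto simp: FSym_act_def split: if_splits)
    have eq: "h \<otimes>\<^bsub>H\<^esub> (inv\<^bsub>H\<^esub> h \<otimes>\<^bsub>H\<^esub> x) = x"
      using x assms(2) by (simp add: m_assoc[symmetric])
    with ne have "f (inv\<^bsub>H\<^esub> h \<otimes>\<^bsub>H\<^esub> x) \<noteq> inv\<^bsub>H\<^esub> h \<otimes>\<^bsub>H\<^esub> x" by auto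
    with eq show "x \<in> (\<lambda>x. h \<otimes>\<^bsub>H\<^esub> x) ` {x. f x \<noteq> x}" by (metis (mono_tags) imageI mem_Collect_eq)
  qed
  ultimately show ?thesis using fin by (auto simp: FSym_simps intro: finite_subset)
qed

lemma FSym_act_one:
  assumes "group H" "f \<in> carrier (FSym H)"
  shows "FSym_act H \<one>\<^bsub>H\<^esub> f = f"
proof -
  interpret group H by fact
  show ?thesis using assms(2)
    by (auto simp: FSym_act_def fun_eq_iff FSym_simps permutes_in_image permutes_not_in)
qed

lemma FSym_act_mult:
  assumes "group H" "h \<in> carrier H" "k \<in> carrier H" "f \<in> carrier (FSym H)"
  shows "FSym_act H (h \<otimes>\<^bsub>H\<^esub> k) f = FSym_act H h (FSym_act H k f)"
proof -
  interpret group H by fact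
  show ?thesis using assms(2-)
    by (auto simp: FSym_act_def fun_eq_iff FSym_simps permutes_in_image m_assoc inv_mult_group)
qed

lemma FSym_act_comp:
  assumes "group H" "h \<in> carrier H" "f \<in> carrier (FSym H)" "g \<in> carrier (FSym H)"
  shows "FSym_act H h (f \<circ> g) = FSym_act H h f \<circ> FSym_act H h g"
proof -
  interpret group H by fact
  show ?thesis using assms(2-)
    by (auto simp: FSym_act_def fun_eq_iff FSym_simps permutes_in_image m_assoc[symmetric])
qed

lemma Shuffler_simps:
  "p \<in> carrier (Shuffler H) \<longleftrightarrow> fst p \<in> carrier (FSym H) \<and> snd p \<in> carrier H"
  "(f, x) \<otimes>\<^bsub>Shuffler H\<^esub> (g, y) = (f \<circ> FSym_act H x g, x \<otimes>\<^bsub>H\<^esub> y)"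
  "\<one>\<^bsub>Shuffler H\<^esub> = (id, \<one>\<^bsub>H\<^esub>)"
  by (cases p) (simp_all add: Shuffler_def FSym_simps)

lemma group_Shuffler:
  assumes H: "group H"
  shows "group (Shuffler H)"
proof -
  interpret H: group H by fact
  interpret F: group "FSym H" by (rule group_FSym)
  have comp: "f \<circ> g \<in> carrier (FSym H)"
    if "f \<in> carrier (FSym H)" "g \<in> carrier (FSym H)" for f g
    using F.m_closed[OF that] by (simp only: FSym_simps(2))
  have idc: "id \<in> carrier (FSym H)" using F.one_closed by (simp only: FSym_simps(3))
  show ?thesis
  proof (rule groupI)
    fix p q assume "p \<in> carrier (Shuffler H)" "q \<in> carrier (Shuffler H)"
    then show "p \<otimes>\<^bsub>Shuffler H\<^esub> q \<in> carrier (Shuffler H)"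
      by (cases p; cases q) (simp add: Shuffler_simps comp FSym_act_closed[OF H])
  next
    fix p q r assume "p \<in> carrier (Shuffler H)" "q \<in> carrier (Shuffler H)"
      "r \<in> carrier (Shuffler H)"
    then show "p \<otimes>\<^bsub>Shuffler H\<^esub> q \<otimes>\<^bsub>Shuffler H\<^esub> r =
        p \<otimes>\<^bsub>Shuffler H\<^esub> (q \<otimes>\<^bsub>Shuffler H\<^esub> r)"
      by (cases p; cases q; cases r)
         (simp add: Shuffler_simps FSym_act_closed[OF H] FSym_act_comp[OF H]
            FSym_act_mult[OF H] H.m_assoc comp_assoc)
  next
    fix p assume "p \<in> carrier (Shuffler H)"
    then show "\<one>\<^bsub>Shuffler H\<^esub> \<otimes>\<^bsub>Shuffler H\<^esub> p = p"
      by (cases p) (simp add: Shuffler_simps FSym_act_one[OF H])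
  next
    fix p assume p: "p \<in> carrier (Shuffler H)"
    obtain f x where px: "p = (f, x)" by (cases p)
    with p have f: "f \<in> carrier (FSym H)" and x: "x \<in> carrier H" by (auto simp: Shuffler_simps)
    obtain f' where f': "f' \<in> carrier (FSym H)" "f' \<circ> f = id"
      using F.l_inv_ex[OF f] by (auto simp: FSym_simps(2,3))
    have "FSym_act H (inv\<^bsub>H\<^esub> x) id = id"
      using x by (auto simp: FSym_act_def fun_eq_iff H.m_assoc[symmetric])
    then have "FSym_act H (inv\<^bsub>H\<^esub> x) f' \<circ> FSym_act H (inv\<^bsub>H\<^esub> x) f = id"
      using FSym_act_comp[OF H _ f'(1) f, of "inv\<^bsub>H\<^esub> x"] f'(2) x by simp
    then show "\<exists>q\<in>carrier (Shuffler H). q \<otimes>\<^bsub>Shuffler H\<^esub> p = \<one>\<^bsub>Shuffler H\<^esub>"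
      using f' x
      by (intro bexI[of _ "(FSym_act H (inv\<^bsub>H\<^esub> x) f', inv\<^bsub>H\<^esub> x)"])
         (simp_all add: px Shuffler_simps FSym_act_closed[OF H])
  qed (simp add: Shuffler_simps idc)
qed

end

(* F_{n+1}(h) differs from F_n(h) exactly when S_n^{-1} h lies in the support of the permutation
   part f of the increment g_{n+1} = (f, x), which is independent of S_n.  Hence the expected number
   of changes is the sum over n of E[sum over y in supp f of P(S_n = h y^{-1})], which is at most
   (sup_x G(x)) E|supp f|, where G(x) = sum_n P(S_n = x) is the Green function.  The word length
   bounds |supp f| up to a constant, so the second factor is finite.  For the first, let q be the
   probability that the walk on H never returns to the identity: decomposing according to the last
   visit to x gives G(x) q = P(there is a last visit to x) <= 1, with equality at the identity by
   transience, so q > 0 and G <= 1/q.  Borel-Cantelli concludes. *)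
theory Submission
  imports Defs
begin

section \<open>Splitting an i.i.d. sequence at a fixed time\<close>

text \<open>\<open>comb_seq n\<close> puts the first n entries of one sequence in front of another
  and carries two independent copies of the law to the law itself. This serves as the Markov
  property at time n: past and future are integrated separately.\<close>

lemma (in sequence_space) nn_integral_comb_seq:
  assumes "f \<in> borel_measurable S"
  shows "(\<integral>\<^sup>+ \<omega>. f \<omega> \<partial>S) = (\<integral>\<^sup>+ \<omega>. \<integral>\<^sup>+ \<omega>'. f (comb_seq n \<omega> \<omega>') \<partial>S \<partial>S)"
proof -
  have "(\<integral>\<^sup>+ \<omega>. f \<omega> \<partial>S) = (\<integral>\<^sup>+ \<omega>. f \<omega> \<partial>distr (S \<Otimes>\<^sub>M S) S (\<lambda>(\<omega>, \<omega>'). comb_seq n \<omega> \<omega>'))"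
    by (simp add: PiM_comb_seq)
  also have "\<dots> = (\<integral>\<^sup>+ z. f (case z of (\<omega>, \<omega>') \<Rightarrow> comb_seq n \<omega> \<omega>') \<partial>(S \<Otimes>\<^sub>M S))"
    by (rule nn_integral_distr[OF measurable_comb_seq]) (simp add: assms)
  also have "\<dots> = (\<integral>\<^sup>+ \<omega>. \<integral>\<^sup>+ \<omega>'. f (comb_seq n \<omega> \<omega>') \<partial>S \<partial>S)"
    by (subst P.nn_integral_fst[symmetric])
       (use measurable_compose[OF measurable_comb_seq assms] in simp_all)
  finally show ?thesis .
qed

(* The increments are b (\<omega> 0), b (\<omega> 1), ... with i.i.d. codes \<omega> i of law \<nu>.  Coding by natural
   numbers is possible since the law of the increments has countable support, and it avoids the
   problem that on an uncountable type multiplication need not be measurable for the product of two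
   discrete sigma-algebras. *)
locale coded_walk = group H for H :: "('a, 'b) monoid_scheme" (structure) +
  fixes b :: "nat \<Rightarrow> 'a" and \<nu> :: "nat pmf"
  assumes b_closed [simp]: "b j \<in> carrier H"
begin

abbreviation P :: "(nat \<Rightarrow> nat) measure" where
  "P \<equiv> \<Pi>\<^sub>M i\<in>UNIV. measure_pmf \<nu>"

text \<open>\<open>random_walk\<close> reads increments from index 1 on, while code sequences start
  at 0; hence the shift. Step n + 1 multiplies by \<open>b (\<omega> n)\<close>.\<close>

definition W :: "nat \<Rightarrow> (nat \<Rightarrow> nat) \<Rightarrow> 'a" where
  "W = random_walk H (\<lambda>i \<omega>. b (\<omega> (i - 1)))"

lemma W_simps [simp]: "W 0 \<omega> = \<one>" "W (Suc n) \<omega> = W n \<omega> \<otimes> b (\<omega> n)"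
  by (simp_all add: W_def)

sublocale seq: sequence_space "measure_pmf \<nu>"
  by unfold_locales

lemma space_P [simp]: "space P = UNIV"
  by (simp add: space_PiM)

lemma W_closed [simp]: "W n \<omega> \<in> carrier H"
  by (induction n) simp_all

lemma W_comb_seq: "W (n + m) (comb_seq n \<omega> \<omega>') = W n \<omega> \<otimes> W m \<omega>'"
proof (induction m)
  case 0
  have "W k (comb_seq n \<omega> \<omega>') = W k \<omega>" if "k \<le> n" for k
    using that by (induction k) (simp_all add: comb_seq_less)
  then show ?case by simp
next
  case (Suc m)
  then show ?case
    using comb_seq_add[of n \<omega> \<omega>' m] by (simp add: m_assoc add.commute)
qed

lemma measurable_coordinate [measurable]: "(\<lambda>\<omega>. \<omega> i) \<in> P \<rightarrow>\<^sub>M count_space UNIV"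
proof -
  have "(\<lambda>\<omega>. \<omega> i) \<in> P \<rightarrow>\<^sub>M measure_pmf \<nu>"
    by (rule measurable_component_singleton) simp
  then show ?thesis by simp
qed

lemma measurable_W [measurable]: "W n \<in> P \<rightarrow>\<^sub>M count_space UNIV"
proof (induction n)
  case (Suc n)
  \<comment> \<open>Right multiplication by a fixed \<open>b j\<close> is measurable on a discrete
    space, and only countably many codes j occur.\<close>
  have "(\<lambda>\<omega>. (\<lambda>j \<omega>. W n \<omega> \<otimes> b j) (\<omega> n) \<omega>) \<in> P \<rightarrow>\<^sub>M count_space UNIV"
    by (rule measurable_compose_countable[OF measurable_compose[OF Suc] measurable_coordinate]) simp
  then show ?case by simp
qed simp

lemma sets_W: "{\<omega>. Q (W n \<omega>)} \<in> sets P"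
  using measurable_sets[OF measurable_W, of "Collect Q" n] by (simp add: vimage_def)

lemma sets_last_exit: "{\<omega>. W n \<omega> = x \<and> (\<forall>m>n. W m \<omega> \<noteq> x)} \<in> sets P"
proof -
  have "{\<omega>. W n \<omega> = x \<and> (\<forall>m>n. W m \<omega> \<noteq> x)} =
      {\<omega>. W n \<omega> = x} \<inter> (\<Inter>m. {\<omega>. n < m \<longrightarrow> W m \<omega> \<noteq> x})" by auto
  also have "\<dots> \<in> sets P"
    by (intro sets.Int sets.countable_INT'')
       (use sets.top[of P] in \<open>auto intro: sets_W[where Q = "\<lambda>y. n < m \<longrightarrow> y \<noteq> x" for m]
          sets_W[where Q = "\<lambda>y. y = x"]\<close>)
  finally show ?thesis .
qed

section \<open>Escape probability and Green function\<close>

text \<open>Taken in \<open>ennreal\<close> so that it can multiply the Green function before that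
  is known to be finite.\<close>

definition escape :: ennreal where
  "escape = emeasure P {\<omega>. \<forall>m>0. W m \<omega> \<noteq> \<one>}"

text \<open>Once the walk is at x, it is at x again exactly when the product of the later increments
  is the identity. These increments are independent of the first n and form a fresh copy of the
  walk, so the probabilities multiply.\<close>

lemma emeasure_last_exit:
  assumes "x \<in> carrier H"
  shows "emeasure P {\<omega>. W n \<omega> = x \<and> (\<forall>m>n. W m \<omega> \<noteq> x)} = emeasure P {\<omega>. W n \<omega> = x} * escape"
    (is "emeasure P ?E = _")
proof -
  \<comment> \<open>The escape event is the last-exit event for n = 0 and the identity, as the walk
    starts there.\<close>
  have [measurable]: "?E \<in> sets P" "{\<omega>. \<forall>m>0. W m \<omega> \<noteq> \<one>} \<in> sets P" "{\<omega>. W n \<omega> = x} \<in> sets P"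
    using sets_last_exit[of 0 \<one>] sets_W[where Q = "\<lambda>y. y = x"] by (simp_all add: sets_last_exit)
  have split: "indicator ?E (comb_seq n \<omega> \<omega>') =
      indicator {\<omega>. W n \<omega> = x} \<omega> * (indicator {\<omega>. \<forall>m>0. W m \<omega> \<noteq> \<one>} \<omega>' :: ennreal)" for \<omega> \<omega>'
  proof -
    have *: "W (n + m) (comb_seq n \<omega> \<omega>') = x \<longleftrightarrow> W m \<omega>' = \<one>" if "W n \<omega> = x" for m
      using that assms by (simp add: W_comb_seq)
    have "(\<forall>m>n. W m (comb_seq n \<omega> \<omega>') \<noteq> x) \<longleftrightarrow> (\<forall>m>0. W m \<omega>' \<noteq> \<one>)" if "W n \<omega> = x"
      using *[OF that] by (metis add.right_neutral less_imp_add_positive nat_add_left_cancel_less)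
    then show ?thesis
      using W_comb_seq[of n 0 \<omega> \<omega>'] by (auto simp: indicator_def)
  qed
  have "emeasure P ?E = (\<integral>\<^sup>+ \<omega>. indicator ?E \<omega> \<partial>P)" by simp
  also have "\<dots> = (\<integral>\<^sup>+ \<omega>. \<integral>\<^sup>+ \<omega>'. indicator ?E (comb_seq n \<omega> \<omega>') \<partial>P \<partial>P)"
    by (rule seq.nn_integral_comb_seq) measurable
  also have "\<dots> = emeasure P {\<omega>. W n \<omega> = x} * escape"
    unfolding split by (simp add: nn_integral_cmult nn_integral_multc escape_def)
  finally show ?thesis .
qed

text \<open>A path has at most one last visit to x, so the last-exit events for different n are
  disjoint and their probabilities add up.\<close>

lemma green_times_escape:
  assumes "x \<in> carrier H"
  shows "(\<Sum>n. emeasure P {\<omega>. W n \<omega> = x}) * escape =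
    emeasure P {\<omega>. \<exists>n. W n \<omega> = x \<and> (\<forall>m>n. W m \<omega> \<noteq> x)}"
proof -
  let ?E = "\<lambda>n. {\<omega>. W n \<omega> = x \<and> (\<forall>m>n. W m \<omega> \<noteq> x)}"
  note [measurable] = sets_last_exit
  have "disjoint_family ?E"
    unfolding disjoint_family_on_def by (auto, metis linorder_neqE_nat)
  then have "(\<Sum>n. emeasure P (?E n)) = emeasure P (\<Union>n. ?E n)"
    by (intro suminf_emeasure) auto
  also have "(\<Union>n. ?E n) = {\<omega>. \<exists>n. W n \<omega> = x \<and> (\<forall>m>n. W m \<omega> \<noteq> x)}" by auto
  finally show ?thesis by (simp add: emeasure_last_exit[OF assms])
qed

lemma green_bound:
  assumes "AE \<omega> in P. \<exists>n. W n \<omega> = \<one> \<and> (\<forall>m>n. W m \<omega> \<noteq> \<one>)" and "x \<in> carrier H"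
  shows "(\<Sum>n. emeasure P {\<omega>. W n \<omega> = x}) \<le> 1 / escape" and "1 / escape < \<top>"
proof -
  have "emeasure P {\<omega>. \<exists>n. W n \<omega> = \<one> \<and> (\<forall>m>n. W m \<omega> \<noteq> \<one>)} = 1"
    using assms(1) by (intro seq.emeasure_eq_1_AE) (auto simp: Collect_ex_eq sets_last_exit)
  \<comment> \<open>In \<open>ennreal\<close>, 0 times infinity is 0, so \<open>escape = 0\<close>
    would give 0 = 1 even if the Green function were infinite.\<close>
  then have pos: "escape \<noteq> 0"
    using green_times_escape[of \<one>] by auto
  have fin: "escape \<noteq> \<top>"
    unfolding escape_def by simp
  have "(\<Sum>n. emeasure P {\<omega>. W n \<omega> = x}) * escape \<le> 1"
    unfolding green_times_escape[OF assms(2)] by (rule seq.measure_le_1)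
  then show "(\<Sum>n. emeasure P {\<omega>. W n \<omega> = x}) \<le> 1 / escape"
    using pos fin by (metis (no_types, lifting) divide_right_mono_ennreal ennreal_mult_divide_eq)
  show "1 / escape < \<top>"
    using pos by (simp add: ennreal_divide_eq_top_iff less_top[symmetric])
qed

section \<open>Finitely many changes by Borel-Cantelli\<close>

text \<open>In the application \<open>A j\<close> is the set of points moved by the increment with
  code j, so the hits are the only times at which the value at h can change. Their expected number
  is at most \<open>1 / escape\<close> times the mean of \<open>card (A j)\<close>.\<close>

lemma AE_finite_hits:
  assumes transient: "AE \<omega> in P. \<exists>n. W n \<omega> = \<one> \<and> (\<forall>m>n. W m \<omega> \<noteq> \<one>)"
    and A: "\<And>j. A j \<subseteq> carrier H" "\<And>j. finite (A j)"
    and moment: "(\<integral>\<^sup>+ j. of_nat (card (A j)) \<partial>\<nu>) < \<infinity>"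
    and h: "h \<in> carrier H"
  shows "AE \<omega> in P. finite {n. inv (W n \<omega>) \<otimes> h \<in> A (\<omega> n)}"
proof -
  let ?B = "\<lambda>n. {\<omega>. inv (W n \<omega>) \<otimes> h \<in> A (\<omega> n)}"
  let ?C = "1 / escape"
  interpret P\<nu>: pair_sigma_finite P "measure_pmf \<nu>" ..
  have sets_hit: "{\<omega>. inv (W n \<omega>) \<otimes> h \<in> A j} \<in> sets P" for n j
    by (rule sets_W)
  have [measurable]: "?B n \<in> sets P" for n
  proof -
    have "?B n = (\<Union>j. {\<omega>. inv (W n \<omega>) \<otimes> h \<in> A j} \<inter> ((\<lambda>\<omega>. \<omega> n) -` {j} \<inter> space P))" by auto
    also have "\<dots> \<in> sets P"
      by (intro sets.countable_UN'' sets.Int sets_hit measurable_sets[OF measurable_coordinate]) auto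
    finally show ?thesis .
  qed
  have bound: "emeasure P (?B n) \<le>
      (\<integral>\<^sup>+ j. (\<Sum>y\<in>A j. emeasure P {\<omega>. W n \<omega> = h \<otimes> inv y}) \<partial>\<nu>)" for n
  proof -
    let ?f = "\<lambda>\<omega> j. indicator {\<omega>. inv (W n \<omega>) \<otimes> h \<in> A j} \<omega> :: ennreal"
    note [measurable] = sets_hit
    have meas_f: "(\<lambda>(\<omega>, j). ?f \<omega> j) \<in> borel_measurable (P \<Otimes>\<^sub>M measure_pmf \<nu>)"
    proof -
      have "(\<lambda>z. (\<lambda>j z. ?f (fst z) j) (snd z) z) \<in> borel_measurable (P \<Otimes>\<^sub>M measure_pmf \<nu>)"
        by (rule measurable_compose_countable) measurable
      then show ?thesis by (simp add: case_prod_beta')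
    qed
    \<comment> \<open>After cutting at time n, the position \<open>W n\<close> depends on the first
      sequence only and the code of the next increment is entry 0 of the second.\<close>
    have "emeasure P (?B n) = (\<integral>\<^sup>+ \<omega>. \<integral>\<^sup>+ \<omega>'. indicator (?B n) (comb_seq n \<omega> \<omega>') \<partial>P \<partial>P)"
      by (subst seq.nn_integral_comb_seq[symmetric]) simp_all
    also have "\<dots> = (\<integral>\<^sup>+ \<omega>. \<integral>\<^sup>+ \<omega>'. ?f \<omega> (\<omega>' 0) \<partial>P \<partial>P)"
    proof -
      have "indicator (?B n) (comb_seq n \<omega> \<omega>') = ?f \<omega> (\<omega>' 0)" for \<omega> \<omega>'
        using W_comb_seq[of n 0 \<omega> \<omega>'] comb_seq_add[of n \<omega> \<omega>' 0] by (simp add: indicator_def)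
      then show ?thesis by simp
    qed
    also have "\<dots> = (\<integral>\<^sup>+ \<omega>. \<integral>\<^sup>+ j. ?f \<omega> j \<partial>\<nu> \<partial>P)"
    proof -
      have first: "(\<integral>\<^sup>+ \<omega>'. u (\<omega>' 0) \<partial>P) = (\<integral>\<^sup>+ j. u j \<partial>\<nu>)" for u :: "nat \<Rightarrow> ennreal"
      proof -
        have "(\<integral>\<^sup>+ \<omega>'. u (\<omega>' 0) \<partial>P) = (\<integral>\<^sup>+ j. u j \<partial>distr P (measure_pmf \<nu>) (\<lambda>\<omega>. \<omega> 0))"
          by (subst nn_integral_distr) (simp_all add: measurable_component_singleton)
        then show ?thesis by (simp add: seq.PiM_component)
      qed
      show ?thesis by (simp only: first[of "?f \<omega>" for \<omega>])
    qed
    also have "\<dots> = (\<integral>\<^sup>+ j. \<integral>\<^sup>+ \<omega>. ?f \<omega> j \<partial>P \<partial>\<nu>)"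
      by (rule P\<nu>.Fubini'[symmetric, OF meas_f])
    also have "\<dots> \<le> (\<integral>\<^sup>+ j. (\<Sum>y\<in>A j. emeasure P {\<omega>. W n \<omega> = h \<otimes> inv y}) \<partial>\<nu>)"
    proof (rule nn_integral_mono)
      fix j
      \<comment> \<open>A hit at y forces the walk to be at \<open>h \<otimes> inv y\<close>, one
        site for each y in \<open>A j\<close>.\<close>
      have "{\<omega>. inv (W n \<omega>) \<otimes> h \<in> A j} \<subseteq> (\<Union>y\<in>A j. {\<omega>. W n \<omega> = h \<otimes> inv y})"
      proof
        fix \<omega> assume "\<omega> \<in> {\<omega>. inv (W n \<omega>) \<otimes> h \<in> A j}"
        moreover have "W n \<omega> = h \<otimes> inv (inv (W n \<omega>) \<otimes> h)"
          using h by (simp add: inv_mult_group m_assoc[symmetric])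
        ultimately show "\<omega> \<in> (\<Union>y\<in>A j. {\<omega>. W n \<omega> = h \<otimes> inv y})" by blast
      qed
      then have "emeasure P {\<omega>. inv (W n \<omega>) \<otimes> h \<in> A j} \<le>
          emeasure P (\<Union>y\<in>A j. {\<omega>. W n \<omega> = h \<otimes> inv y})"
        using A(2) by (intro emeasure_mono) (auto intro: sets_W)
      also have "\<dots> \<le> (\<Sum>y\<in>A j. emeasure P {\<omega>. W n \<omega> = h \<otimes> inv y})"
        by (rule emeasure_subadditive_finite) (use A(2) in \<open>auto intro: sets_W\<close>)
      finally show "(\<integral>\<^sup>+ \<omega>. ?f \<omega> j \<partial>P) \<le> (\<Sum>y\<in>A j. emeasure P {\<omega>. W n \<omega> = h \<otimes> inv y})"
        by simp
    qed
    finally show ?thesis .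
  qed
  have "(\<Sum>n. emeasure P (?B n)) \<le>
      (\<Sum>n. \<integral>\<^sup>+ j. (\<Sum>y\<in>A j. emeasure P {\<omega>. W n \<omega> = h \<otimes> inv y}) \<partial>\<nu>)"
    by (intro suminf_le bound) auto
  also have "\<dots> = (\<integral>\<^sup>+ j. (\<Sum>n. \<Sum>y\<in>A j. emeasure P {\<omega>. W n \<omega> = h \<otimes> inv y}) \<partial>\<nu>)"
    by (rule nn_integral_suminf[symmetric]) simp
  also have "\<dots> \<le> (\<integral>\<^sup>+ j. ?C * of_nat (card (A j)) \<partial>\<nu>)"
  proof (rule nn_integral_mono)
    fix j
    have "(\<Sum>n. \<Sum>y\<in>A j. emeasure P {\<omega>. W n \<omega> = h \<otimes> inv y}) =
        (\<Sum>y\<in>A j. \<Sum>n. emeasure P {\<omega>. W n \<omega> = h \<otimes> inv y})"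
      by (rule suminf_sum) simp
    \<comment> \<open>The Green bound is uniform over the sites, so only the number of points y
      matters.\<close>
    also have "\<dots> \<le> (\<Sum>y\<in>A j. ?C)"
      using A(1)[of j] h by (intro sum_mono green_bound(1)[OF transient]) auto
    finally show "(\<Sum>n. \<Sum>y\<in>A j. emeasure P {\<omega>. W n \<omega> = h \<otimes> inv y}) \<le> ?C * of_nat (card (A j))"
      by (simp add: mult.commute)
  qed
  also have "\<dots> = ?C * (\<integral>\<^sup>+ j. of_nat (card (A j)) \<partial>\<nu>)"
    by (rule nn_integral_cmult) simp
  also have "\<dots> < \<top>"
    using moment green_bound(2)[OF transient h] by (simp add: ennreal_mult_less_top)
  finally have "(\<Sum>n. ennreal (measure P (?B n))) < \<top>"
    by (simp add: seq.emeasure_eq_measure)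
  then have "summable (\<lambda>n. measure P (?B n))"
    by (intro summable_suminf_not_top) auto
  then have "AE \<omega> in P. eventually (\<lambda>n. \<omega> \<in> space P - ?B n) sequentially"
    by (intro borel_cantelli_AE1) (auto simp: less_top[symmetric])
  then show ?thesis
  proof eventually_elim
    case (elim \<omega>)
    then obtain N where "\<And>n. n \<ge> N \<Longrightarrow> \<omega> \<notin> ?B n"
      by (auto simp: eventually_sequentially)
    then have "{n. inv (W n \<omega>) \<otimes> h \<in> A (\<omega> n)} \<subseteq> {..<N}"
      by (auto simp: not_le[symmetric])
    then show ?case by (rule finite_subset) simp
  qed
qed

end

section \<open>Word length and size of the support\<close>

lemma (in group) foldr_mult_closed:
  "set v \<subseteq> carrier G \<Longrightarrow> foldr (\<otimes>) v \<one> \<in> carrier G"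
  by (induction v) auto

lemma (in group) foldr_mult_start:
  assumes "set v \<subseteq> carrier G" "x \<in> carrier G"
  shows "foldr (\<otimes>) v x = foldr (\<otimes>) v \<one> \<otimes> x"
  using assms by (induction v) (auto simp: foldr_mult_closed m_assoc)

text \<open>Products correspond to concatenated words. The existence of a word makes the
  \<open>LEAST\<close> in \<open>word_length\<close> range over a nonempty set.\<close>

lemma (in group) generate_word:
  assumes "S \<subseteq> carrier G" and "x \<in> generate G S"
  shows "\<exists>w. set w \<subseteq> S \<union> (\<lambda>s. inv s) ` S \<and> foldr (\<otimes>) w \<one> = x"
  using assms(2)
proof induction
  case one
  show ?case by (intro exI[of _ "[]"]) simp
next
  case (incl s)
  then show ?case using assms(1) by (intro exI[of _ "[s]"]) auto
next
  case (inv s)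
  then show ?case using assms(1) by (intro exI[of _ "[inv s]"]) auto
next
  case (eng x y)
  then obtain v w where "set v \<subseteq> S \<union> (\<lambda>s. inv s) ` S" "foldr (\<otimes>) v \<one> = x"
      "set w \<subseteq> S \<union> (\<lambda>s. inv s) ` S" "foldr (\<otimes>) w \<one> = y" by blast
  moreover from this have "set v \<subseteq> carrier G" "set w \<subseteq> carrier G" using assms(1) by auto
  ultimately show ?case
    by (intro exI[of _ "v @ w"]) (auto simp: foldr_mult_start[of v "foldr _ w _"] foldr_mult_closed)
qed

lemma (in group) word_length_attained:
  assumes "S \<subseteq> carrier G" and "x \<in> generate G S"
  obtains w where "length w = word_length G S x" "set w \<subseteq> S \<union> (\<lambda>s. inv s) ` S"
    "foldr (\<otimes>) w \<one> = x"
proof -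
  let ?P = "\<lambda>n. \<exists>w. length w = n \<and> set w \<subseteq> S \<union> (\<lambda>s. inv s) ` S \<and> foldr (\<otimes>) w \<one> = x"
  have "\<exists>n. ?P n" using generate_word[OF assms] by blast
  then have "?P (LEAST n. ?P n)" by (rule LeastI_ex)
  then show thesis using that unfolding word_length_def by blast
qed

definition moved :: "('a \<Rightarrow> 'a) \<times> 'b \<Rightarrow> 'a set" where
  "moved p = {x. fst p x \<noteq> x}"

lemma moved_Shuffler:
  assumes "p \<in> carrier (Shuffler H)"
  shows "finite (moved p)" "moved p \<subseteq> carrier H"
  using assms by (auto simp: moved_def Shuffler_simps FSym_simps dest: permutes_not_in)

text \<open>The product has permutation part f composed with the translate of k by x. It moves only
  points of the support of f or of the x-translate of the support of k, and translating does not
  enlarge a finite set.\<close>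

lemma card_moved_mult:
  assumes "group H" and p: "p \<in> carrier (Shuffler H)" and q: "q \<in> carrier (Shuffler H)"
  shows "card (moved (p \<otimes>\<^bsub>Shuffler H\<^esub> q)) \<le> card (moved p) + card (moved q)"
proof -
  interpret group H by fact
  obtain f x where px: "p = (f, x)" by (cases p)
  obtain k y where qy: "q = (k, y)" by (cases q)
  have x: "x \<in> carrier H" using p by (simp add: px Shuffler_simps)
  have "moved (p \<otimes>\<^bsub>Shuffler H\<^esub> q) \<subseteq> moved p \<union> (\<lambda>z. x \<otimes>\<^bsub>H\<^esub> z) ` moved q"
  proof
    fix z assume z: "z \<in> moved (p \<otimes>\<^bsub>Shuffler H\<^esub> q)"
    show "z \<in> moved p \<union> (\<lambda>z. x \<otimes>\<^bsub>H\<^esub> z) ` moved q"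
    proof (cases "FSym_act H x k z = z")
      case True
      with z show ?thesis by (simp add: moved_def px qy Shuffler_simps)
    next
      case False
      then have zH: "z \<in> carrier H" by (auto simp: FSym_act_def split: if_splits)
      have eq: "x \<otimes>\<^bsub>H\<^esub> (inv\<^bsub>H\<^esub> x \<otimes>\<^bsub>H\<^esub> z) = z"
        using x zH by (simp add: m_assoc[symmetric])
      with False zH have "inv\<^bsub>H\<^esub> x \<otimes>\<^bsub>H\<^esub> z \<in> moved q"
        by (auto simp: FSym_act_def moved_def qy)
      with eq show ?thesis by (metis UnI2 imageI)
    qed
  qed
  then have "card (moved (p \<otimes>\<^bsub>Shuffler H\<^esub> q)) \<le> card (moved p \<union> (\<lambda>z. x \<otimes>\<^bsub>H\<^esub> z) ` moved q)"
    using moved_Shuffler(1)[OF p] moved_Shuffler(1)[OF q] by (intro card_mono) auto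
  also have "\<dots> \<le> card (moved p) + card (moved q)"
    using moved_Shuffler(1)[OF q] by (meson card_Un_le card_image_le add_left_mono order_trans)
  finally show ?thesis .
qed

text \<open>By subadditivity each letter of a word contributes at most K moved points; this is
  applied to a shortest word.\<close>

lemma card_moved_le_word_length:
  assumes H: "group H" and S: "finite S" "S \<subseteq> carrier (Shuffler H)"
    and gen: "generate (Shuffler H) S = carrier (Shuffler H)"
  obtains K where "\<And>p. p \<in> carrier (Shuffler H) \<Longrightarrow>
    card (moved p) \<le> K * word_length (Shuffler H) S p"
proof -
  let ?G = "Shuffler H"
  interpret G: group ?G by (rule group_Shuffler[OF H])
  let ?S = "S \<union> (\<lambda>s. inv\<^bsub>?G\<^esub> s) ` S"
  \<comment> \<open>A sum dominates each of its terms and, unlike a maximum, also makes sense for an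
    empty generating set.\<close>
  define K where "K = (\<Sum>s\<in>?S. card (moved s))"
  have S_closed: "?S \<subseteq> carrier ?G" using S(2) by auto
  have word: "card (moved (foldr (\<otimes>\<^bsub>?G\<^esub>) w \<one>\<^bsub>?G\<^esub>)) \<le> K * length w" if "set w \<subseteq> ?S" for w
    using that
  proof (induction w)
    case Nil
    then show ?case by (simp add: moved_def Shuffler_simps)
  next
    case (Cons s w)
    have "card (moved (s \<otimes>\<^bsub>?G\<^esub> foldr (\<otimes>\<^bsub>?G\<^esub>) w \<one>\<^bsub>?G\<^esub>)) \<le>
        card (moved s) + card (moved (foldr (\<otimes>\<^bsub>?G\<^esub>) w \<one>\<^bsub>?G\<^esub>))"
      using Cons.prems S_closed by (intro card_moved_mult[OF H] G.foldr_mult_closed) auto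
    moreover have "card (moved s) \<le> K"
      unfolding K_def using Cons.prems S(1) by (intro member_le_sum) auto
    ultimately show ?case using Cons by simp
  qed
  show thesis
  proof (rule that)
    fix p assume "p \<in> carrier ?G"
    then obtain w where "length w = word_length ?G S p" "set w \<subseteq> ?S"
        "foldr (\<otimes>\<^bsub>?G\<^esub>) w \<one>\<^bsub>?G\<^esub> = p"
      using G.word_length_attained[OF S(2)] gen by metis
    then show "card (moved p) \<le> K * word_length ?G S p" using word by metis
  qed
qed

lemma nn_integral_card_moved_less_top:
  assumes H: "group H" and \<mu>: "set_pmf \<mu> \<subseteq> carrier (Shuffler H)"
    and moment: "finite_first_moment (Shuffler H) \<mu>"
  shows "(\<integral>\<^sup>+ p. of_nat (card (moved p)) \<partial>\<mu>) < (\<infinity> :: ennreal)"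
proof -
  let ?G = "Shuffler H"
  obtain S where S: "finite S" "S \<subseteq> carrier ?G" "generate ?G S = carrier ?G"
    and summable: "(\<lambda>p. real (word_length ?G S p) * pmf \<mu> p) summable_on carrier ?G"
    using moment unfolding finite_first_moment_def by blast
  obtain K where K: "\<And>p. p \<in> carrier ?G \<Longrightarrow> card (moved p) \<le> K * word_length ?G S p"
    using card_moved_le_word_length[OF H S] by blast
  let ?l = "\<lambda>p. real (word_length ?G S p)"
  \<comment> \<open>For real families \<open>summable_on\<close> is absolute summability, which is
    integrability for counting measure.\<close>
  have "integrable (count_space (carrier ?G)) (\<lambda>p. ?l p * pmf \<mu> p)"
    using summable
    by (simp add: abs_summable_on_def[symmetric] abs_summable_equivalent[symmetric]
        summable_on_iff_abs_summable_on_real[symmetric])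
  then have fin: "(\<integral>\<^sup>+ p. ennreal (?l p * pmf \<mu> p) \<partial>count_space (carrier ?G)) < \<infinity>"
    by (simp add: integrable_iff_bounded)
  have "(\<integral>\<^sup>+ p. of_nat (card (moved p)) \<partial>\<mu>) =
      (\<integral>\<^sup>+ p. ennreal (pmf \<mu> p) * of_nat (card (moved p)) \<partial>count_space UNIV)"
    by (rule nn_integral_measure_pmf)
  also have "\<dots> = (\<integral>\<^sup>+ p. ennreal (pmf \<mu> p) * of_nat (card (moved p)) \<partial>count_space (carrier ?G))"
    using \<mu> by (intro nn_integral_count_space_eq) (auto simp: pmf_eq_0_set_pmf)
  also have "\<dots> \<le> (\<integral>\<^sup>+ p. of_nat K * ennreal (?l p * pmf \<mu> p) \<partial>count_space (carrier ?G))"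
  proof (rule nn_integral_mono)
    fix p assume "p \<in> space (count_space (carrier ?G))"
    then have "real (card (moved p)) \<le> real K * ?l p"
      using K[of p] by (metis of_nat_le_iff of_nat_mult space_count_space)
    then have "pmf \<mu> p * real (card (moved p)) \<le> real K * (?l p * pmf \<mu> p)"
      using mult_left_mono[of "real (card (moved p))" "real K * ?l p" "pmf \<mu> p"]
      by (simp add: mult_ac)
    then show "ennreal (pmf \<mu> p) * of_nat (card (moved p)) \<le> of_nat K * ennreal (?l p * pmf \<mu> p)"
      by (simp add: ennreal_of_nat_eq_real_of_nat ennreal_mult[symmetric] ennreal_leI)
  qed
  also have "\<dots> = of_nat K * (\<integral>\<^sup>+ p. ennreal (?l p * pmf \<mu> p) \<partial>count_space (carrier ?G))"
    by (rule nn_integral_cmult) simp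
  also have "\<dots> < \<infinity>"
    using fin by (simp add: ennreal_mult_less_top of_nat_less_top)
  finally show ?thesis .
qed

section \<open>Law of the increment sequence and effect of one step\<close>

text \<open>Independence makes the law of the family over the positive integers a product measure;
  reindexing along the injection \<open>Suc\<close> moves it to all naturals.\<close>

lemma (in prob_space) distr_shifted_iid:
  assumes indep: "indep_vars (\<lambda>_. N) X {1..}" and law: "\<And>i. i \<ge> 1 \<Longrightarrow> distr M N (X i) = N"
  shows "distr M (\<Pi>\<^sub>M i\<in>UNIV. N) (\<lambda>\<omega> i. X (Suc i) \<omega>) = (\<Pi>\<^sub>M i\<in>UNIV. N)"
proof -
  have X: "X i \<in> M \<rightarrow>\<^sub>M N" if "i \<ge> 1" for i
    using indep that by (simp add: indep_vars_def)
  interpret N: prob_space N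
    using prob_space_distr[OF X[of 1]] law[of 1] by simp
  let ?K = "\<Pi>\<^sub>M i\<in>{1::nat..}. N" and ?I = "\<Pi>\<^sub>M i\<in>(UNIV :: nat set). N"
  have K: "distr M ?K (\<lambda>\<omega>. \<lambda>i\<in>{1..}. X i \<omega>) = ?K"
  proof -
    have "distr M ?K (\<lambda>\<omega>. \<lambda>i\<in>{1..}. X i \<omega>) = (\<Pi>\<^sub>M i\<in>{1..}. distr M N (X i))"
      using indep by (subst indep_vars_iff_distr_eq_PiM'[symmetric]) (auto intro: X)
    also have "\<dots> = ?K" by (rule PiM_cong) (auto simp: law)
    finally show ?thesis .
  qed
  have restrict_X: "(\<lambda>\<omega>. \<lambda>i\<in>{1..}. X i \<omega>) \<in> M \<rightarrow>\<^sub>M ?K"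
    by (intro measurable_restrict X) auto
  have shift: "(\<lambda>\<omega> i. \<omega> (Suc i)) \<in> ?K \<rightarrow>\<^sub>M ?I"
    by (intro measurable_PiM_single') (auto simp: space_PiM PiE_iff)
  have "?I = distr ?K ?I (\<lambda>\<omega> i. \<omega> (Suc i))"
    using distr_PiM_reindex[of "{1..}" "\<lambda>_. N" Suc UNIV] N.prob_space_axioms by (simp add: restrict_def)
  also have "\<dots> = distr (distr M ?K (\<lambda>\<omega>. \<lambda>i\<in>{1..}. X i \<omega>)) ?I (\<lambda>\<omega> i. \<omega> (Suc i))"
    by (simp only: K)
  also have "\<dots> = distr M ?I (\<lambda>\<omega> i. X (Suc i) \<omega>)"
    by (subst distr_distr[OF shift restrict_X]) (simp add: comp_def)
  finally show ?thesis ..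
qed

text \<open>If f is the permutation part of increment n + 1, the new value at h is F_n(S_n
  f(S_n^{-1} h)), and the argument of F_n is h when f fixes S_n^{-1} h.\<close>

lemma perm_coord_Suc_eq:
  assumes "h \<in> carrier H" and "inv\<^bsub>H\<^esub> (base_coord H g n \<omega>) \<otimes>\<^bsub>H\<^esub> h \<notin> moved (g (Suc n) \<omega>)"
    and "group H" "base_coord H g n \<omega> \<in> carrier H"
  shows "perm_coord H g (Suc n) \<omega> h = perm_coord H g n \<omega> h"
proof -
  interpret group H by fact
  have "base_coord H g n \<omega> \<otimes>\<^bsub>H\<^esub> (inv\<^bsub>H\<^esub> (base_coord H g n \<omega>) \<otimes>\<^bsub>H\<^esub> h) = h"
    using assms(1,4) by (simp add: m_assoc[symmetric])
  then show ?thesis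
    using assms(1,2)
    by (simp add: perm_coord_def base_coord_def moved_def Shuffler_def FSym_simps FSym_act_def
        split_beta)
qed

section \<open>Stabilization of the permutation coordinate\<close>

theorem lemma1p1:
  fixes H :: "('a, 'b) monoid_scheme"
    and \<mu> :: "(('a \<Rightarrow> 'a) \<times> 'a) pmf"
    and M :: "'w measure"
    and g :: "nat \<Rightarrow> 'w \<Rightarrow> ('a \<Rightarrow> 'a) \<times> 'a"
    and h :: 'a
  assumes "group H"
    and "finitely_generated H"
    and "set_pmf \<mu> \<subseteq> carrier (Shuffler H)"
    and "finite_first_moment (Shuffler H) \<mu>"
    and "prob_space M"
    and "iid_increments M g \<mu>"
    and "transient_walk M H (base_coord H g)"
    and "h \<in> carrier H"
  shows "AE \<omega> in M. \<exists>N\<ge>1. \<forall>n\<ge>N. perm_coord H g n \<omega> h = perm_coord H g N \<omega> h"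
proof -
  interpret M: prob_space M by fact
  let ?code = "to_nat_on (set_pmf \<mu>)" and ?d = "from_nat_into (set_pmf \<mu>)"
  define \<nu> where "\<nu> = map_pmf ?code \<mu>"
  have decode: "?d (?code p) = p" if "p \<in> set_pmf \<mu>" for p
    using that by (simp add: countable_set_pmf)
  \<comment> \<open>This covers every j, also those that code nothing: there
    \<open>from_nat_into\<close> returns some element of the nonempty support.\<close>
  have d_set: "?d j \<in> set_pmf \<mu>" for j
    by (rule from_nat_into[OF set_pmf_not_empty])
  then have d_closed: "?d j \<in> carrier (Shuffler H)" for j
    using assms(3) by blast
  interpret coded_walk H "\<lambda>j. snd (?d j)" \<nu>
    using assms(1) d_closed by (auto simp: coded_walk_def coded_walk_axioms_def Shuffler_simps)
  have meas_g: "g i \<in> M \<rightarrow>\<^sub>M count_space UNIV" and law_g: "distr M (count_space UNIV) (g i) = measure_pmf \<mu>"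
    if "i \<ge> 1" for i
    using assms(6) that by (auto simp: iid_increments_def M.indep_vars_def)
  \<comment> \<open>\<open>T\<close> sends a sample point to its code sequence, with entry i coding
    increment i + 1 as \<open>W\<close> expects.\<close>
  define T where "T = (\<lambda>\<omega> i. ?code (g (Suc i) \<omega>))"
  have T_law: "distr M P T = P"
    unfolding T_def
  proof (rule M.distr_shifted_iid)
    show "M.indep_vars (\<lambda>_. measure_pmf \<nu>) (\<lambda>i \<omega>. ?code (g i \<omega>)) {1..}"
      using assms(6) by (intro M.indep_vars_compose2[where Y = "\<lambda>_. ?code"])
        (auto simp: iid_increments_def)
    fix i :: nat assume i: "i \<ge> 1"
    have "distr M (measure_pmf \<nu>) (\<lambda>\<omega>. ?code (g i \<omega>)) =
        distr (distr M (count_space UNIV) (g i)) (count_space UNIV) ?code"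
      using meas_g[OF i] by (subst distr_distr) (auto simp: comp_def intro: distr_cong)
    also have "\<dots> = measure_pmf \<nu>"
      by (simp add: law_g[OF i] \<nu>_def map_pmf_rep_eq)
    finally show "distr M (measure_pmf \<nu>) (\<lambda>\<omega>. ?code (g i \<omega>)) = measure_pmf \<nu>" .
  qed
  have T_meas: "T \<in> M \<rightarrow>\<^sub>M P"
    unfolding T_def using measurable_compose[OF meas_g, of _ ?code "count_space UNIV"]
    by (intro measurable_PiM_single') auto
  \<comment> \<open>Decoding inverts the code on the support of \<mu>, where almost surely all of
    the countably many increments lie.\<close>
  have AE_decode: "AE \<omega> in M. \<forall>i. ?d (T \<omega> i) = g (Suc i) \<omega>"
  proof (subst AE_all_countable, rule allI)
    fix i
    have "AE p in distr M (count_space UNIV) (g (Suc i)). ?d (?code p) = p"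
      by (subst law_g) (simp_all add: AE_measure_pmf_iff decode)
    then show "AE \<omega> in M. ?d (T \<omega> i) = g (Suc i) \<omega>"
      unfolding T_def by (rule AE_distrD[OF meas_g, rotated]) simp
  qed
  have base: "base_coord H g n \<omega> = W n (T \<omega>)" if "\<forall>i. ?d (T \<omega> i) = g (Suc i) \<omega>" for n \<omega>
    unfolding base_coord_eq_random_walk by (induction n) (simp_all add: that)

  have "AE \<omega> in M. \<exists>n. W n (T \<omega>) = \<one>\<^bsub>H\<^esub> \<and> (\<forall>m>n. W m (T \<omega>) \<noteq> \<one>\<^bsub>H\<^esub>)"
    using AE_decode assms(7)[unfolded transient_walk_def]
  proof eventually_elim
    case (elim \<omega>)
    \<comment> \<open>Time 0 is a visit to the identity, so a finite set of visits has a maximum,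
      the last visit.\<close>
    let ?V = "{n. W n (T \<omega>) = \<one>\<^bsub>H\<^esub>}"
    have "finite ?V" using elim by (simp add: base)
    moreover have "?V \<noteq> {}" using W_simps(1) by blast
    ultimately have "Max ?V \<in> ?V" "\<forall>m\<in>?V. m \<le> Max ?V"
      by (rule Max_in) (simp add: \<open>finite ?V\<close>)
    then show ?case by (metis (mono_tags, lifting) leD mem_Collect_eq)
  qed
  then have transient: "AE \<omega> in P. \<exists>n. W n \<omega> = \<one>\<^bsub>H\<^esub> \<and> (\<forall>m>n. W m \<omega> \<noteq> \<one>\<^bsub>H\<^esub>)"
    by (subst T_law[symmetric], subst AE_distr_iff[OF T_meas])
       (auto simp: Collect_ex_eq sets_last_exit)

  have "(\<integral>\<^sup>+ j. of_nat (card (moved (?d j))) \<partial>\<nu>) = (\<integral>\<^sup>+ p. of_nat (card (moved p)) \<partial>\<mu>)"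
    unfolding \<nu>_def nn_integral_map_pmf
    by (intro nn_integral_cong_AE) (simp add: AE_measure_pmf_iff decode)
  then have "(\<integral>\<^sup>+ j. of_nat (card (moved (?d j))) \<partial>\<nu>) < (\<infinity> :: ennreal)"
    using nn_integral_card_moved_less_top[OF assms(1,3,4)] by simp
  then have "AE \<omega> in P. finite {n. inv\<^bsub>H\<^esub> (W n \<omega>) \<otimes>\<^bsub>H\<^esub> h \<in> moved (?d (\<omega> n))}"
    using moved_Shuffler[OF d_closed] assms(8)
    by (intro AE_finite_hits[OF transient, where A = "\<lambda>j. moved (?d j)"]) auto
  then have "AE \<omega> in M. finite {n. inv\<^bsub>H\<^esub> (W n (T \<omega>)) \<otimes>\<^bsub>H\<^esub> h \<in> moved (?d (T \<omega> n))}"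
    by (intro AE_distrD[OF T_meas]) (simp only: T_law)
  with AE_decode show ?thesis
  proof eventually_elim
    case (elim \<omega>)
    then obtain N where N: "\<And>n. inv\<^bsub>H\<^esub> (W n (T \<omega>)) \<otimes>\<^bsub>H\<^esub> h \<in> moved (?d (T \<omega> n)) \<Longrightarrow> n < N"
      unfolding finite_nat_set_iff_bounded by auto
    have stay: "perm_coord H g (Suc n) \<omega> h = perm_coord H g n \<omega> h" if "n \<ge> N" for n
      using that N[of n] elim(1) assms(1,8)
      by (intro perm_coord_Suc_eq) (auto simp: base)
    \<comment> \<open>Starting from \<open>Suc N\<close> provides the required index of at least
      1.\<close>
    have "perm_coord H g n \<omega> h = perm_coord H g (Suc N) \<omega> h" if "n \<ge> Suc N" for n
      using that
    proof (induction n rule: dec_induct)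
      case (step n)
      then show ?case by (metis Suc_leD stay)
    qed simp
    then show ?case by (metis le_add1 plus_1_eq_Suc)
  qed
qed

end
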